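(* If $T$ is a caterpillar, then $\chi_{\mathrm{cen}}(T)\leq\chi_{\mathrm{lin}}(T)+1$. Furthermore, there exist caterpillars $T$ with $\chi_{\mathrm{cen}}(T)=\chi_{\mathrm{lin}}(T)+1$.
   Context: A caterpillar is a tree such that removing all its leaves yields a path. A centered coloring of a graph $G$ assigns integers (colors) to vertices so that every connected subgraph contains a vertex whose color is unique in that subgraph; $\chi_{\mathrm{cen}}(G)$ is the minimum number of colors of such a coloring. A linear coloring requires the same only for every path of $G$ (as a subgraph); $\chi_{\mathrm{lin}}(G)$ is the minimum number of colors of a linear coloring. *)

theory Defs
  imports Main
begin

text \<open>
  A finite simple undirected graph is given by its vertex set \<open>V\<close> and its set \<open>E\<close> of
  two-element edges.
\<close>

definition simple_graph :: "'a set \<Rightarrow> 'a set set \<Rightarrow> bool" where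
  "simple_graph V E \<longleftrightarrow> finite V \<and> (\<forall>e\<in>E. e \<subseteq> V \<and> card e = 2)"

definition subgraph :: "'a set \<Rightarrow> 'a set set \<Rightarrow> 'a set \<Rightarrow> 'a set set \<Rightarrow> bool" where
  "subgraph W F V E \<longleftrightarrow> simple_graph W F \<and> W \<subseteq> V \<and> F \<subseteq> E"

definition connected_graph :: "'a set \<Rightarrow> 'a set set \<Rightarrow> bool" where
  "connected_graph V E \<longleftrightarrow>
     simple_graph V E \<and> V \<noteq> {} \<and> (\<forall>u\<in>V. \<forall>v\<in>V. (u, v) \<in> {(x, y). {x, y} \<in> E}\<^sup>*)"

definition path_edges :: "'a list \<Rightarrow> 'a set set" where
  "path_edges xs = {{xs ! i, xs ! Suc i} | i. Suc i < length xs}"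

definition path_graph :: "'a set \<Rightarrow> 'a set set \<Rightarrow> bool" where
  "path_graph V E \<longleftrightarrow> (\<exists>xs. xs \<noteq> [] \<and> distinct xs \<and> V = set xs \<and> E = path_edges xs)"

definition has_cycle :: "'a set set \<Rightarrow> bool" where
  "has_cycle E \<longleftrightarrow>
     (\<exists>xs. distinct xs \<and> length xs \<ge> 3 \<and> path_edges xs \<subseteq> E \<and> {last xs, hd xs} \<in> E)"

definition tree :: "'a set \<Rightarrow> 'a set set \<Rightarrow> bool" where
  "tree V E \<longleftrightarrow> connected_graph V E \<and> \<not> has_cycle E"

definition degree :: "'a set set \<Rightarrow> 'a \<Rightarrow> nat" where
  "degree E v = card {e \<in> E. v \<in> e}"

definition leaves :: "'a set \<Rightarrow> 'a set set \<Rightarrow> 'a set" where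
  "leaves V E = {v \<in> V. degree E v = 1}"

text \<open>
  The path that remains may be empty. This happens only for the tree with two vertices, which
  is a caterpillar like every other path.
\<close>

definition caterpillar :: "'a set \<Rightarrow> 'a set set \<Rightarrow> bool" where
  "caterpillar V E \<longleftrightarrow>
     tree V E \<and>
     (let W = V - leaves V E in W = {} \<or> path_graph W {e \<in> E. e \<subseteq> W})"

definition has_center :: "('a \<Rightarrow> int) \<Rightarrow> 'a set \<Rightarrow> bool" where
  "has_center c W \<longleftrightarrow> (\<exists>v\<in>W. \<forall>u\<in>W. c u = c v \<longrightarrow> u = v)"

definition centered_coloring :: "'a set \<Rightarrow> 'a set set \<Rightarrow> ('a \<Rightarrow> int) \<Rightarrow> bool" where
  "centered_coloring V E c \<longleftrightarrow>
     (\<forall>W F. subgraph W F V E \<and> connected_graph W F \<longrightarrow> has_center c W)"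

definition linear_coloring :: "'a set \<Rightarrow> 'a set set \<Rightarrow> ('a \<Rightarrow> int) \<Rightarrow> bool" where
  "linear_coloring V E c \<longleftrightarrow>
     (\<forall>W F. subgraph W F V E \<and> path_graph W F \<longrightarrow> has_center c W)"

text \<open>
  Both minima exist for finite \<open>V\<close>, since a coloring that is injective on \<open>V\<close> is centered and
  linear.
\<close>

definition chi_cen :: "'a set \<Rightarrow> 'a set set \<Rightarrow> nat" where
  "chi_cen V E = (LEAST k. \<exists>c. centered_coloring V E c \<and> card (c ` V) = k)"

definition chi_lin :: "'a set \<Rightarrow> 'a set set \<Rightarrow> nat" where
  "chi_lin V E = (LEAST k. \<exists>c. linear_coloring V E c \<and> card (c ` V) = k)"

end

theory Submission
  imports Defs
begin

text \<open>
  A connected subgraph of a caterpillar that is not a single leaf meets the spine in the vertex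
  set of a subpath. Hence a linear coloring of the caterpillar becomes centered once all leaves
  are recolored with one fresh color.

  The bound is attained by the spine \<open>0 - 1 - 2 - 3\<close> with one leaf \<open>4 + i\<close> at every spine vertex
  \<open>i\<close>: coloring \<open>v\<close> by \<open>v mod 3\<close> is linear. On the other hand, deleting any vertex leaves a path
  on four vertices, which needs three colors in a centered coloring, so that the whole graph
  needs four.
\<close>

section \<open>Edge cuts, paths and leaves in connected graphs\<close>

lemma connected_graph_crossing_edge:
  assumes "connected_graph W F" "u \<in> W" "w \<in> W" "u \<in> S" "w \<notin> S"
  obtains x y where "{x, y} \<in> F" "x \<in> S" "y \<notin> S"
proof (rule ccontr)
  assume "\<not> thesis"
  with that have no: "\<And>x y. {x, y} \<in> F \<Longrightarrow> x \<in> S \<Longrightarrow> y \<in> S" by blast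
  have "(u, w) \<in> {(x, y). {x, y} \<in> F}\<^sup>*"
    using assms by (auto simp: connected_graph_def)
  then have "w \<in> S"
    by (induction rule: rtrancl_induct) (use assms no in auto)
  with assms show False by simp
qed

text \<open>Some edge of \<open>F\<close> crosses the boundary of \<open>S\<close>, and
  \<open>e\<close> is the only candidate in \<open>E\<close>. The condition on \<open>S\<close>
  speaks of single edges, so for an explicit edge list the simplifier can discharge it.\<close>

lemma connected_graph_bridge_mem:
  assumes "connected_graph W F" "F \<subseteq> E" "u \<in> W" "w \<in> W" "u \<in> S" "w \<notin> S"
    and "\<forall>d\<in>E. d \<subseteq> S \<or> d \<inter> S = {} \<or> d = e"
  shows "e \<in> F"
proof -
  obtain x y where xy: "{x, y} \<in> F" "x \<in> S" "y \<notin> S"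
    using connected_graph_crossing_edge[OF assms(1,3-6)] .
  with assms(2,7) have "{x, y} \<subseteq> S \<or> {x, y} \<inter> S = {} \<or> {x, y} = e" by (meson subsetD)
  then have "{x, y} = e" using xy(2,3) by simp
  then show ?thesis using xy(1) by simp
qed

lemma path_edges_singleton: "path_edges [x] = {}"
  by (simp add: path_edges_def)

lemma path_edges_Cons: "path_edges (x # y # ys) = insert {x, y} (path_edges (y # ys))"
proof
  show "path_edges (x # y # ys) \<subseteq> insert {x, y} (path_edges (y # ys))"
    by (auto simp: path_edges_def less_Suc_eq_0_disj)
  show "insert {x, y} (path_edges (y # ys)) \<subseteq> path_edges (x # y # ys)"
    unfolding path_edges_def by (force intro: exI[of _ 0] exI[of _ "Suc _"])
qed

lemma path_edges_neighbor:
  assumes "distinct xs" "k < length xs" "{xs ! k, y} \<in> path_edges xs"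
  shows "(Suc k < length xs \<and> y = xs ! Suc k) \<or> (0 < k \<and> y = xs ! (k - 1))"
proof -
  from assms(3) obtain i where i: "Suc i < length xs" "{xs ! k, y} = {xs ! i, xs ! Suc i}"
    unfolding path_edges_def by blast
  then consider "xs ! k = xs ! i" "y = xs ! Suc i" | "xs ! k = xs ! Suc i" "y = xs ! i"
    by (auto simp: doubleton_eq_iff)
  then show ?thesis
    using i(1) assms(1,2) by cases (auto simp: nth_eq_iff_index_eq)
qed

text \<open>Neighbors of a vertex sit at the positions next to its own, of which there are at most
  two. Together with connectedness, this is all that the verification of the coloring of the comb
  uses about paths.\<close>

lemma path_edges_at_most_two_neighbors:
  assumes "distinct xs" "{v, a} \<in> path_edges xs" "{v, b} \<in> path_edges xs" "{v, d} \<in> path_edges xs"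
  shows "a = b \<or> a = d \<or> b = d"
proof -
  from assms(2) obtain i where "Suc i < length xs" "{v, a} = {xs ! i, xs ! Suc i}"
    unfolding path_edges_def by blast
  then obtain k where "k < length xs" "v = xs ! k"
    by (metis Suc_lessD doubleton_eq_iff)
  with path_edges_neighbor[OF assms(1), of k] assms(2-4) show ?thesis by metis
qed

lemma path_graph_connected:
  assumes "path_graph W F"
  shows "connected_graph W F"
proof -
  obtain xs where xs: "xs \<noteq> []" "distinct xs" "W = set xs" "F = path_edges xs"
    using assms by (auto simp: path_graph_def)
  let ?R = "{(x, y). {x, y} \<in> F}"
  have edge: "{xs ! i, xs ! Suc i} \<in> F" if "Suc i < length xs" for i
    using that xs by (auto simp: path_edges_def)
  have sym: "sym ?R" by (auto simp: sym_def insert_commute)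
  have from_hd: "i < length xs \<Longrightarrow> (xs ! 0, xs ! i) \<in> ?R\<^sup>*" for i
  proof (induction i)
    case (Suc i)
    with edge[of i] show ?case by (auto intro: rtrancl_into_rtrancl)
  qed simp
  have "(u, v) \<in> ?R\<^sup>*" if "u \<in> W" "v \<in> W" for u v
    using that from_hd sym_rtrancl[OF sym] unfolding xs(3) in_set_conv_nth sym_def
    by (metis (no_types, lifting) rtrancl_trans)
  moreover have "simple_graph W F"
    using xs by (auto simp: simple_graph_def path_edges_def card_insert_if nth_eq_iff_index_eq)
  ultimately show ?thesis
    using xs by (auto simp: connected_graph_def)
qed

lemma leaf_edge_unique:
  assumes "v \<in> leaves V E" "e \<in> E" "e' \<in> E" "v \<in> e" "v \<in> e'"
  shows "e = e'"
proof -
  from assms(1) obtain d where "{e \<in> E. v \<in> e} = {d}"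
    unfolding leaves_def degree_def by (auto simp: card_1_singleton_iff)
  with assms(2-) show ?thesis by (metis (mono_tags, lifting) mem_Collect_eq singletonD)
qed

text \<open>An edge leaving \<open>{u, y}\<close> would be a second edge at one of the two
  leaves.\<close>

lemma adjacent_leaves_only_vertices:
  assumes "connected_graph V E" "u \<in> leaves V E" "y \<in> leaves V E" "{u, y} \<in> E"
  shows "V = {u, y}"
proof -
  have "u \<in> V" "y \<in> V" using assms by (auto simp: leaves_def)
  moreover have "w \<in> {u, y}" if w: "w \<in> V" for w
  proof (rule ccontr)
    assume "w \<notin> {u, y}"
    then obtain x z where "{x, z} \<in> E" "x \<in> {u, y}" "z \<notin> {u, y}"
      using connected_graph_crossing_edge[OF assms(1) \<open>u \<in> V\<close> w, of "{u, y}"] by blast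
    with leaf_edge_unique[of x V E "{x, z}" "{u, y}"] assms show False by blast
  qed
  ultimately show ?thesis by blast
qed

lemma simple_graph_edge_vertices:
  assumes "simple_graph V E" "{x, y} \<in> E"
  shows "x \<in> V" "y \<in> V"
  using assms by (auto simp: simple_graph_def)

lemma degree_eq_card_neighbors:
  assumes "simple_graph V E"
  shows "degree E v = card {y. {v, y} \<in> E}"
proof -
  have "\<exists>y. e = {v, y}" if "e \<in> E" "v \<in> e" for e
  proof -
    have "card e = 2" using assms that(1) by (simp add: simple_graph_def)
    then show ?thesis using that(2) by (auto simp: card_2_iff)
  qed
  then have "{e \<in> E. v \<in> e} = (\<lambda>y. {v, y}) ` {y. {v, y} \<in> E}" by auto
  moreover have "inj_on (\<lambda>y. {v, y}) {y. {v, y} \<in> E}"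
    by (auto simp: inj_on_def doubleton_eq_iff)
  ultimately show ?thesis unfolding degree_def by (simp add: card_image)
qed

section \<open>Recoloring the leaves of a caterpillar\<close>

text \<open>A leaf hangs on a single vertex and cannot serve as a detour, so every inner vertex of
  the spine separates the spine vertices before it from those after it.\<close>

lemma connected_subgraph_meets_spine_in_interval:
  assumes G: "simple_graph V E" and U: "connected_graph U F" "F \<subseteq> E"
    and xs: "distinct xs" "V - leaves V E = set xs" "{e \<in> E. e \<subseteq> set xs} = path_edges xs"
    and ab: "a \<le> i" "i \<le> b" "b < length xs" "xs ! a \<in> U" "xs ! b \<in> U"
  shows "xs ! i \<in> U"
proof (rule ccontr)
  assume i: "xs ! i \<notin> U"
  with ab have lt: "a < i" "i < b" by (metis le_neq_implies_less)+
  \<comment> \<open>\<open>S\<close> is the part of the graph before \<open>xs ! i\<close>: the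
    earlier spine vertices with the leaves attached to them. An edge that leaves \<open>S\<close>
    can only end in \<open>xs ! i\<close>, which is assumed to lie outside \<open>U\<close>.\<close>
  define S where "S = {x. \<exists>j<i. x = xs ! j \<or> (x \<in> leaves V E \<and> {x, xs ! j} \<in> E)}"
  have "xs ! a \<in> S" using lt by (auto simp: S_def)
  moreover have "xs ! b \<notin> S"
  proof
    assume "xs ! b \<in> S"
    moreover have "xs ! b \<notin> leaves V E" using xs(2) ab(3) nth_mem by blast
    ultimately obtain j where "j < i" "xs ! b = xs ! j" by (auto simp: S_def)
    then show False using lt ab(3) xs(1) by (simp add: nth_eq_iff_index_eq)
  qed
  ultimately obtain x y where xy: "{x, y} \<in> F" "x \<in> S" "y \<notin> S"
    using connected_graph_crossing_edge[OF U(1) ab(4,5)] by blast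
  have "y \<in> U" using xy(1) U(1) by (auto simp: connected_graph_def simple_graph_def)
  have E: "{x, y} \<in> E" using xy(1) U(2) by blast
  from xy(2) obtain j where j: "j < i" "x = xs ! j \<or> (x \<in> leaves V E \<and> {x, xs ! j} \<in> E)"
    by (auto simp: S_def)
  from j(2) show False
  proof
    assume x: "x = xs ! j"
    have "y \<notin> leaves V E" using xy(3) j(1) E x by (auto simp: S_def insert_commute)
    then have "y \<in> set xs" using simple_graph_edge_vertices[OF G E] xs(2) by blast
    then have "{xs ! j, y} \<in> path_edges xs" using E x xs(3) j(1) lt ab(3) by fastforce
    then consider "y = xs ! Suc j" | "0 < j" "y = xs ! (j - 1)"
      using path_edges_neighbor[OF xs(1), of j y] j(1) lt ab(3) by auto
    then show False
    proof cases
      case 1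
      then have "Suc j \<noteq> i" using i \<open>y \<in> U\<close> by auto
      then have "y \<in> S" using j(1) 1 by (auto simp: S_def intro!: exI[of _ "Suc j"])
      then show False using xy(3) by simp
    next
      case 2
      then have "y \<in> S" using j(1) by (auto simp: S_def intro!: exI[of _ "j - 1"])
      then show False using xy(3) by simp
    qed
  next
    assume x: "x \<in> leaves V E \<and> {x, xs ! j} \<in> E"
    then have "{x, y} = {x, xs ! j}" using leaf_edge_unique[of x V E] E by blast
    then have "y = xs ! j" by (auto simp: doubleton_eq_iff)
    then show False using xy(3) j(1) by (auto simp: S_def)
  qed
qed

lemma centered_coloring_fresh_leaf_color:
  assumes con: "connected_graph V E" and lin: "linear_coloring V E c" and d: "d \<notin> c ` V"
    and xs: "xs \<noteq> []" "distinct xs" "V - leaves V E = set xs"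
      "{e \<in> E. e \<subseteq> set xs} = path_edges xs"
  shows "centered_coloring V E (\<lambda>v. if v \<in> leaves V E then d else c v)"
    (is "centered_coloring V E ?c")
  unfolding centered_coloring_def
proof (intro allI impI)
  fix U F
  assume "subgraph U F V E \<and> connected_graph U F"
  then have U: "connected_graph U F" "F \<subseteq> E" "U \<subseteq> V" "U \<noteq> {}"
    by (auto simp: subgraph_def connected_graph_def)
  have G: "simple_graph V E" using con by (simp add: connected_graph_def)
  show "has_center ?c U"
  proof (cases "U \<subseteq> leaves V E")
    case True
    from U(4) obtain u where u: "u \<in> U" by blast
    have "w = u" if w: "w \<in> U" for w
    proof (rule ccontr)
      assume "w \<noteq> u"
      then obtain x y where xy: "{x, y} \<in> F" "x \<in> {u}" "y \<notin> {u}"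
        using connected_graph_crossing_edge[OF U(1) u w, of "{u}"] by blast
      then have "y \<in> U" using U(1) by (auto simp: connected_graph_def simple_graph_def)
      \<comment> \<open>Two adjacent leaves would be the whole graph, contradicting the nonempty
        spine. So a connected subgraph consisting of leaves has just one vertex, which is its own
        center.\<close>
      then have "V = {u, y}"
        using adjacent_leaves_only_vertices[OF con, of u y] xy U(2) True u by blast
      then have "V \<subseteq> leaves V E" using True u \<open>y \<in> U\<close> by blast
      then show False using xs(1,3) by (metis Diff_eq_empty_iff set_empty)
    qed
    then show ?thesis using u by (auto simp: has_center_def)
  next
    case False
    \<comment> \<open>\<open>I\<close> collects the positions of the spine vertices in
      \<open>U\<close>; by the interval lemma it has no gaps between its minimum and its
      maximum.\<close>
    define I where "I = {i. i < length xs \<and> xs ! i \<in> U}"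
    have "U - leaves V E = U \<inter> set xs" using U(3) xs(3) by blast
    also have "\<dots> = (!) xs ` I" by (auto simp: I_def in_set_conv_nth)
    finally have spine: "U - leaves V E = (!) xs ` I" .
    have I: "finite I" "I \<noteq> {}" using False spine by (auto simp: I_def)
    define a b where "a = Min I" and "b = Max I"
    have ab: "a \<in> I" "b \<in> I" "\<And>i. i \<in> I \<Longrightarrow> a \<le> i \<and> i \<le> b"
      using I by (auto simp: a_def b_def)
    have "i \<in> I" if "a \<le> i" "i \<le> b" for i
      using connected_subgraph_meets_spine_in_interval[OF G U(1,2) xs(2-4) that] ab(1,2) that
      by (auto simp: I_def)
    then have I_eq: "I = {a..b}" using ab(3) by (metis atLeastAtMost_iff subsetI subset_antisym)
    have b: "b < length xs" using ab(2) by (simp add: I_def)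
    \<comment> \<open>The linear coloring is applied to this subpath as a subgraph of the whole
      caterpillar, so its edges only have to lie in \<open>E\<close>, not in
      \<open>F\<close>.\<close>
    define ys where "ys = map ((!) xs) [a..<Suc b]"
    have "a \<le> b" using ab(2,3) by blast
    then have ys: "ys \<noteq> []" "distinct ys" "set ys = U - leaves V E"
      using xs(2) b unfolding ys_def spine I_eq
      by (auto simp: distinct_map inj_on_def nth_eq_iff_index_eq atLeastLessThanSuc_atLeastAtMost
          simp del: upt_Suc)
    have "path_edges ys \<subseteq> path_edges xs"
    proof
      fix e assume "e \<in> path_edges ys"
      then obtain i where "Suc i < length ys" "e = {ys ! i, ys ! Suc i}"
        by (auto simp: path_edges_def)
      then have "Suc (a + i) < length xs" "e = {xs ! (a + i), xs ! Suc (a + i)}"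
        using b by (auto simp: ys_def simp del: upt_Suc)
      then show "e \<in> path_edges xs" by (auto simp: path_edges_def)
    qed
    then have "path_edges ys \<subseteq> E" using xs(4) by blast
    moreover have P: "path_graph (set ys) (path_edges ys)"
      using ys by (auto simp: path_graph_def)
    ultimately have "subgraph (set ys) (path_edges ys) V E"
      using path_graph_connected[OF P] ys(3) U(3) by (auto simp: subgraph_def connected_graph_def)
    then have "has_center c (U - leaves V E)"
      using lin P ys(3) by (auto simp: linear_coloring_def)
    then obtain v where v: "v \<in> U - leaves V E"
      "\<And>u. u \<in> U - leaves V E \<Longrightarrow> c u = c v \<Longrightarrow> u = v"
      by (auto simp: has_center_def)
    \<comment> \<open>The center \<open>v\<close> of the subpath keeps its color, and the leaves in
      \<open>U\<close> all carry the fresh color \<open>d\<close>, so \<open>v\<close> remains a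
      center of \<open>U\<close>.\<close>
    moreover have "c v \<noteq> d" using v(1) U(3) d by auto
    ultimately show ?thesis
      unfolding has_center_def by (intro bexI[of _ v]) auto
  qed
qed

section \<open>Existence of optimal colorings\<close>

text \<open>Injective colorings show that both \<open>LEAST\<close> operators range over a nonempty
  set, and they settle the upper bound for the tree that has no spine.\<close>

lemma inj_on_int_coloring_exists:
  assumes "finite V"
  obtains c :: "'a \<Rightarrow> int" where "inj_on c V"
proof -
  from finite_imp_inj_to_nat_seg[OF assms] obtain f :: "'a \<Rightarrow> nat" where "inj_on f V" by blast
  then have "inj_on (\<lambda>x. int (f x)) V" by (auto simp: inj_on_def)
  then show ?thesis using that by blast
qed

lemma has_center_inj_on:
  assumes "inj_on c V" "W \<subseteq> V" "W \<noteq> {}"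
  shows "has_center c W"
  using assms unfolding has_center_def inj_on_def by blast

lemma inj_on_centered_coloring: "inj_on c V \<Longrightarrow> centered_coloring V E c"
  by (auto simp: centered_coloring_def subgraph_def connected_graph_def intro: has_center_inj_on)

lemma inj_on_linear_coloring: "inj_on c V \<Longrightarrow> linear_coloring V E c"
  by (auto simp: linear_coloring_def subgraph_def path_graph_def intro: has_center_inj_on)

lemma chi_cen_le: "centered_coloring V E c \<Longrightarrow> chi_cen V E \<le> card (c ` V)"
  unfolding chi_cen_def by (rule Least_le) auto

lemma chi_lin_le: "linear_coloring V E c \<Longrightarrow> chi_lin V E \<le> card (c ` V)"
  unfolding chi_lin_def by (rule Least_le) auto

lemma chi_cen_attained:
  assumes "finite V"
  obtains c where "centered_coloring V E c" "card (c ` V) = chi_cen V E"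
proof -
  obtain c :: "'a \<Rightarrow> int" where "inj_on c V" using inj_on_int_coloring_exists[OF assms] .
  then have "\<exists>k c. centered_coloring V E c \<and> card (c ` V) = k"
    using inj_on_centered_coloring by blast
  from LeastI_ex[OF this] show ?thesis using that unfolding chi_cen_def by blast
qed

lemma chi_lin_attained:
  assumes "finite V"
  obtains c where "linear_coloring V E c" "card (c ` V) = chi_lin V E"
proof -
  obtain c :: "'a \<Rightarrow> int" where "inj_on c V" using inj_on_int_coloring_exists[OF assms] .
  then have "\<exists>k c. linear_coloring V E c \<and> card (c ` V) = k"
    using inj_on_linear_coloring by blast
  from LeastI_ex[OF this] show ?thesis using that unfolding chi_lin_def by blast
qed

section \<open>The upper bound for caterpillars\<close>

lemma caterpillar_chi_cen_le:
  assumes "caterpillar V E"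
  shows "chi_cen V E \<le> chi_lin V E + 1"
proof -
  have con: "connected_graph V E" using assms by (simp add: caterpillar_def tree_def)
  then have fin: "finite V" and "V \<noteq> {}" by (auto simp: connected_graph_def simple_graph_def)
  obtain c where c: "linear_coloring V E c" "card (c ` V) = chi_lin V E"
    using chi_lin_attained[OF fin] .
  show ?thesis
  proof (cases "V - leaves V E = {}")
    \<comment> \<open>If every vertex is a leaf, there are at most two vertices. Then two colors
      suffice for a centered coloring, while any coloring of a nonempty graph uses at least
      one.\<close>
    case True
    from \<open>V \<noteq> {}\<close> obtain u where u: "u \<in> V" by blast
    have "card V \<le> 2"
    proof (cases "V = {u}")
      case False
      with u obtain w where "w \<in> V" "w \<notin> {u}" by blast
      then obtain x y where xy: "{x, y} \<in> E" "x \<in> {u}"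
        using connected_graph_crossing_edge[OF con u, of w "{u}"] by blast
      moreover have "y \<in> V"
        using simple_graph_edge_vertices[OF _ xy(1)] con by (simp add: connected_graph_def)
      ultimately have "V = {u, y}"
        using adjacent_leaves_only_vertices[OF con, of u y] u True by blast
      then show ?thesis by (simp add: card_insert_if)
    qed simp
    moreover obtain c' :: "'a \<Rightarrow> int" where "inj_on c' V" using inj_on_int_coloring_exists[OF fin] .
    ultimately have "chi_cen V E \<le> 2"
      using chi_cen_le[OF inj_on_centered_coloring] by (metis card_image order_trans)
    moreover have "card (c ` V) > 0" using fin \<open>V \<noteq> {}\<close> by (simp add: card_gt_0_iff)
    ultimately show ?thesis using c(2) by simp
  next
    case False
    then have "path_graph (V - leaves V E) {e \<in> E. e \<subseteq> V - leaves V E}"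
      using assms by (simp add: caterpillar_def Let_def)
    then obtain xs where xs: "xs \<noteq> []" "distinct xs" "V - leaves V E = set xs"
      "{e \<in> E. e \<subseteq> set xs} = path_edges xs"
      by (auto simp: path_graph_def)
    obtain d where d: "d \<notin> c ` V"
      using ex_new_if_finite[OF infinite_UNIV_int] fin by blast
    let ?c = "\<lambda>v. if v \<in> leaves V E then d else c v"
    have "chi_cen V E \<le> card (?c ` V)"
      by (rule chi_cen_le[OF centered_coloring_fresh_leaf_color[OF con c(1) d xs]])
    also have "\<dots> \<le> card (insert d (c ` V))"
      by (rule card_mono) (use fin in auto)
    also have "\<dots> = chi_lin V E + 1" using fin d c(2) by simp
    finally show ?thesis .
  qed
qed

section \<open>Lower bounds for centered colorings\<close>

text \<open>The color of a center of \<open>W\<close> occurs nowhere else in \<open>W\<close>, so it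
  adds one to the colors of any set avoiding the center. Since it is not known which vertex is the
  center, the bound \<open>k\<close> is required for each \<open>v\<close>, with a set
  \<open>U\<close> that may depend on \<open>v\<close>. The lemma is applied in turn to an edge, a
  path on four vertices and the comb.\<close>

lemma centered_coloring_card_Suc:
  assumes "centered_coloring V E c" "subgraph W F V E" "connected_graph W F"
    and "\<And>v. v \<in> W \<Longrightarrow> \<exists>U \<subseteq> W - {v}. k \<le> card (c ` U)"
  shows "Suc k \<le> card (c ` W)"
proof -
  have fin: "finite W" using assms(3) by (simp add: connected_graph_def simple_graph_def)
  obtain v where v: "v \<in> W" "\<And>u. u \<in> W \<Longrightarrow> c u = c v \<Longrightarrow> u = v"
    using assms(1-3) unfolding centered_coloring_def has_center_def by blast
  from assms(4)[OF v(1)] obtain U where U: "U \<subseteq> W - {v}" "k \<le> card (c ` U)" by blast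
  have "finite U" using U(1) fin finite_subset by blast
  moreover have "c v \<notin> c ` U" using U(1) v(2) by fastforce
  ultimately have "Suc k \<le> card (insert (c v) (c ` U))" using U(2) by simp
  also have "\<dots> \<le> card (c ` W)"
    by (rule card_mono) (use fin U(1) v(1) in auto)
  finally show ?thesis .
qed

lemma centered_coloring_path_two:
  assumes "centered_coloring V E c" "simple_graph V E" "{a, b} \<in> E"
  shows "2 \<le> card (c ` {a, b})"
proof -
  have "a \<noteq> b" using assms(2,3) by (auto simp: simple_graph_def)
  then have P: "path_graph {a, b} {{a, b}}"
    unfolding path_graph_def by (intro exI[of _ "[a, b]"])
      (auto simp: path_edges_Cons path_edges_singleton)
  have sub: "subgraph {a, b} {{a, b}} V E"
    using path_graph_connected[OF P] assms(2,3)
    by (auto simp: subgraph_def connected_graph_def simple_graph_def)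
  have "Suc 1 \<le> card (c ` {a, b})"
  proof (rule centered_coloring_card_Suc[OF assms(1) sub path_graph_connected[OF P]])
    fix v assume "v \<in> {a, b}"
    then have "{a} \<subseteq> {a, b} - {v} \<or> {b} \<subseteq> {a, b} - {v}" using \<open>a \<noteq> b\<close> by auto
    moreover have "1 \<le> card (c ` {w})" for w by simp
    ultimately show "\<exists>U \<subseteq> {a, b} - {v}. 1 \<le> card (c ` U)" by blast
  qed
  then show ?thesis by simp
qed

text \<open>Whichever vertex is the center, one of the two end edges avoids it and already carries
  two colors.\<close>

lemma centered_coloring_path_four:
  assumes "centered_coloring V E c" "simple_graph V E" "distinct [p, q, r, s]"
    and E: "{p, q} \<in> E" "{q, r} \<in> E" "{r, s} \<in> E"
  shows "3 \<le> card (c ` {p, q, r, s})"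
proof -
  let ?F = "path_edges [p, q, r, s]"
  have P: "path_graph {p, q, r, s} ?F"
    unfolding path_graph_def using assms(3) by (intro exI[of _ "[p, q, r, s]"]) auto
  have "?F \<subseteq> E" using E by (simp add: path_edges_Cons path_edges_singleton)
  then have sub: "subgraph {p, q, r, s} ?F V E"
    using path_graph_connected[OF P] assms(2) E
    by (auto simp: subgraph_def connected_graph_def simple_graph_def)
  have "Suc 2 \<le> card (c ` {p, q, r, s})"
  proof (rule centered_coloring_card_Suc[OF assms(1) sub path_graph_connected[OF P]])
    fix v assume "v \<in> {p, q, r, s}"
    then have "{p, q} \<subseteq> {p, q, r, s} - {v} \<or> {r, s} \<subseteq> {p, q, r, s} - {v}"
      using assms(3) by auto
    then show "\<exists>U \<subseteq> {p, q, r, s} - {v}. 2 \<le> card (c ` U)"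
      using centered_coloring_path_two[OF assms(1,2) E(1)]
        centered_coloring_path_two[OF assms(1,2) E(3)] by metis
  qed
  then show ?thesis by simp
qed

section \<open>A criterion for acyclicity\<close>

text \<open>The largest vertex of a cycle has two different neighbors on the cycle, both smaller.
  The comb is numbered so that no vertex has two smaller neighbors.\<close>

lemma acyclic_if_unique_smaller_neighbor:
  fixes E :: "'a::linorder set set"
  assumes "\<And>v x y. {v, x} \<in> E \<Longrightarrow> {v, y} \<in> E \<Longrightarrow> x < v \<Longrightarrow> y < v \<Longrightarrow> x = y"
  shows "\<not> has_cycle E"
proof
  assume "has_cycle E"
  then obtain xs where xs: "distinct xs" "length xs \<ge> 3" "path_edges xs \<subseteq> E" "{last xs, hd xs} \<in> E"
    by (auto simp: has_cycle_def)
  let ?n = "length xs"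
  \<comment> \<open>Indices modulo the length treat the closing edge like the others.\<close>
  have edge: "{xs ! i, xs ! (Suc i mod ?n)} \<in> E" if "i < ?n" for i
  proof (cases "Suc i < ?n")
    case True
    then show ?thesis using xs(3) by (auto simp: path_edges_def)
  next
    case False
    with that have i: "Suc i = ?n" by simp
    then have "i = ?n - 1" "xs \<noteq> []" using xs(2) by auto
    then have "last xs = xs ! i" "hd xs = xs ! 0"
      by (simp_all add: last_conv_nth hd_conv_nth)
    then show ?thesis using xs(4) i by simp
  qed
  obtain k where k: "k < ?n" "xs ! k = Max (set xs)"
    using Max_in[of "set xs"] xs(2) by (metis List.finite_set in_set_conv_nth list.size(3)
        not_numeral_le_zero set_empty)
  \<comment> \<open>\<open>l\<close> is the cyclic predecessor of \<open>k\<close>; it differs from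
    the cyclic successor because the length is at least 3.\<close>
  define l where "l = (if k = 0 then ?n - 1 else k - 1)"
  have l: "l < ?n" "Suc l mod ?n = k" "l \<noteq> k" "Suc k mod ?n \<noteq> l" "Suc k mod ?n \<noteq> k"
    using k(1) xs(2) by (auto simp: l_def mod_Suc)
  have less: "xs ! i < xs ! k" if "i < ?n" "i \<noteq> k" for i
    using that k xs(1) by (metis List.finite_set Max_ge nless_le nth_eq_iff_index_eq nth_mem)
  have m: "Suc k mod ?n < ?n" by (rule mod_less_divisor) (use k(1) in linarith)
  have "{xs ! k, xs ! l} \<in> E" using edge[OF l(1)] l(2) by (simp add: insert_commute)
  with edge[OF k(1)] have "xs ! (Suc k mod ?n) = xs ! l"
    using assms less[OF m l(5)] less[OF l(1,3)] by blast
  then show False using xs(1) m l(1,4) by (simp add: nth_eq_iff_index_eq)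
qed

section \<open>The comb, a caterpillar attaining the bound\<close>

definition comb_vertices :: "nat set" where
  "comb_vertices = {0, 1, 2, 3, 4, 5, 6, 7}"

definition comb_edges :: "nat set set" where
  "comb_edges = {{0, 1}, {1, 2}, {2, 3}, {0, 4}, {1, 5}, {2, 6}, {3, 7}}"

lemma comb_simple: "simple_graph comb_vertices comb_edges"
  by (auto simp: simple_graph_def comb_vertices_def comb_edges_def)

lemma comb_connected: "connected_graph comb_vertices comb_edges"
proof -
  let ?R = "{(x, y). {x, y} \<in> comb_edges}"
  have sym: "sym ?R" by (auto simp: sym_def insert_commute)
  have step: "(0, y) \<in> ?R\<^sup>*" if "(0, x) \<in> ?R\<^sup>*" "{x, y} \<in> comb_edges" for x y
    using that by (auto intro: rtrancl_into_rtrancl)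
  have r0: "(0, 0) \<in> ?R\<^sup>*" by simp
  have r1: "(0, 1) \<in> ?R\<^sup>*" by (rule step[OF r0]) (simp add: comb_edges_def)
  have r2: "(0, 2) \<in> ?R\<^sup>*" by (rule step[OF r1]) (simp add: comb_edges_def)
  have r3: "(0, 3) \<in> ?R\<^sup>*" by (rule step[OF r2]) (simp add: comb_edges_def)
  have r4: "(0, 4) \<in> ?R\<^sup>*" by (rule step[OF r0]) (simp add: comb_edges_def)
  have r5: "(0, 5) \<in> ?R\<^sup>*" by (rule step[OF r1]) (simp add: comb_edges_def)
  have r6: "(0, 6) \<in> ?R\<^sup>*" by (rule step[OF r2]) (simp add: comb_edges_def)
  have r7: "(0, 7) \<in> ?R\<^sup>*" by (rule step[OF r3]) (simp add: comb_edges_def)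
  have "(0, v) \<in> ?R\<^sup>*" if "v \<in> comb_vertices" for v
    using that r0 r1 r2 r3 r4 r5 r6 r7 unfolding comb_vertices_def by blast
  then have "(u, v) \<in> ?R\<^sup>*" if "u \<in> comb_vertices" "v \<in> comb_vertices" for u v
    using that sym_rtrancl[OF sym] unfolding sym_def by (meson rtrancl_trans)
  then show ?thesis
    using comb_simple by (auto simp: connected_graph_def comb_vertices_def)
qed

text \<open>Listing both orientations reduces adjacency to comparing numerals instead of two-element
  sets.\<close>

lemma comb_edges_iff:
  "{x, y} \<in> comb_edges \<longleftrightarrow> (x, y) \<in> {(0, 1), (1, 0), (1, 2), (2, 1), (2, 3), (3, 2), (0, 4), (4, 0),
     (1, 5), (5, 1), (2, 6), (6, 2), (3, 7), (7, 3)}"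
  by (simp add: comb_edges_def doubleton_eq_iff disj_assoc)

lemma comb_leaves: "leaves comb_vertices comb_edges = {4, 5, 6, 7}"
proof -
  have "{y. {0, y} \<in> comb_edges} = {1, 4}" "{y. {1, y} \<in> comb_edges} = {0, 2, 5}"
    "{y. {2, y} \<in> comb_edges} = {1, 3, 6}" "{y. {3, y} \<in> comb_edges} = {2, 7}"
    "{y. {4, y} \<in> comb_edges} = {0}" "{y. {5, y} \<in> comb_edges} = {1}"
    "{y. {6, y} \<in> comb_edges} = {2}" "{y. {7, y} \<in> comb_edges} = {3}"
    unfolding comb_edges_iff by auto
  then have "degree comb_edges 0 = 2" "degree comb_edges 1 = 3"
    "degree comb_edges 2 = 3" "degree comb_edges 3 = 2"
    "degree comb_edges 4 = 1" "degree comb_edges 5 = 1"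
    "degree comb_edges 6 = 1" "degree comb_edges 7 = 1"
    unfolding degree_eq_card_neighbors[OF comb_simple] by simp_all
  then show ?thesis unfolding leaves_def comb_vertices_def by auto
qed

lemma comb_caterpillar: "caterpillar comb_vertices comb_edges"
proof -
  have "\<not> has_cycle comb_edges"
    by (rule acyclic_if_unique_smaller_neighbor) (auto simp: comb_edges_iff)
  moreover have W: "comb_vertices - leaves comb_vertices comb_edges = {0, 1, 2, 3}"
    by (simp only: comb_leaves) (auto simp: comb_vertices_def)
  moreover have "path_graph {0, 1, 2, 3} {e \<in> comb_edges. e \<subseteq> {0, 1, 2, 3}}"
  proof -
    have "path_edges [0, 1, 2, 3 :: nat] = {{0, 1}, {1, 2}, {2, 3}}"
      by (auto simp: path_edges_Cons path_edges_singleton)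
    moreover have "{e \<in> comb_edges. e \<subseteq> {0, 1, 2, 3}} = {{0, 1}, {1, 2}, {2, 3}}"
    proof -
      have "\<forall>e\<in>comb_edges. e \<subseteq> {0, 1, 2, 3} \<longleftrightarrow> e \<in> {{0, 1}, {1, 2}, {2, 3}}"
        by (simp add: comb_edges_def doubleton_eq_iff)
      moreover have "{{0, 1}, {1, 2}, {2, 3}} \<subseteq> comb_edges" by (simp add: comb_edges_def)
      ultimately show ?thesis by blast
    qed
    ultimately show ?thesis
      unfolding path_graph_def by (intro exI[of _ "[0, 1, 2, 3]"]) simp
  qed
  ultimately show ?thesis
    using comb_connected unfolding caterpillar_def tree_def Let_def by simp
qed

text \<open>The color classes are \<open>{0, 3, 6}\<close>, \<open>{1, 4, 7}\<close> and
  \<open>{2, 5}\<close>. In a path without a center every vertex has a twin, another vertex of its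
  color on the path. Following twins across the bridges of the comb forces a third neighbor at
  vertex 2 or leaves no vertex at all.\<close>

lemma comb_linear_coloring: "linear_coloring comb_vertices comb_edges (\<lambda>v. int (v mod 3))"
  unfolding linear_coloring_def
proof (intro allI impI)
  fix W F
  assume sub: "subgraph W F comb_vertices comb_edges \<and> path_graph W F"
  then have con: "connected_graph W F" and FE: "F \<subseteq> comb_edges" and WV: "W \<subseteq> comb_vertices"
    using path_graph_connected by (auto simp: subgraph_def)
  have "W \<noteq> {}" and sg: "simple_graph W F" using con by (auto simp: connected_graph_def)
  have deg: "a = b \<or> a = d \<or> b = d" if "{v, a} \<in> F" "{v, b} \<in> F" "{v, d} \<in> F" for v a b d
    using sub path_edges_at_most_two_neighbors that unfolding path_graph_def by metis
  \<comment> \<open>In each of the next five facts a single edge of the comb leaves the chosen set,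
    so a connected subgraph with vertices on both sides contains this edge.\<close>
  have end5: "w \<in> W \<Longrightarrow> 5 \<in> W \<Longrightarrow> w \<noteq> 5 \<Longrightarrow> {1, 5} \<in> F" for w
    by (rule connected_graph_bridge_mem[OF con FE, of 5 w "{5}"])
      (simp_all add: comb_edges_def insert_commute)
  have end6: "w \<in> W \<Longrightarrow> 6 \<in> W \<Longrightarrow> w \<noteq> 6 \<Longrightarrow> {2, 6} \<in> F" for w
    by (rule connected_graph_bridge_mem[OF con FE, of 6 w "{6}"])
      (simp_all add: comb_edges_def insert_commute)
  have cut01: "u \<in> W \<Longrightarrow> w \<in> W \<Longrightarrow> u \<in> {0, 4} \<Longrightarrow> w \<notin> {0, 4} \<Longrightarrow> {1, 0} \<in> F" for u w
    by (rule connected_graph_bridge_mem[OF con FE, of u w "{0, 4}"])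
      (simp_all add: comb_edges_def insert_commute)
  have cut12: "u \<in> W \<Longrightarrow> w \<in> W \<Longrightarrow> u \<in> {0, 1, 4, 5} \<Longrightarrow> w \<notin> {0, 1, 4, 5} \<Longrightarrow> {1, 2} \<in> F" for u w
    by (rule connected_graph_bridge_mem[OF con FE, of u w "{0, 1, 4, 5}"])
      (simp_all add: comb_edges_def insert_commute)
  have cut23: "u \<in> W \<Longrightarrow> w \<in> W \<Longrightarrow> u \<in> {3, 7} \<Longrightarrow> w \<notin> {3, 7} \<Longrightarrow> {2, 3} \<in> F" for u w
    by (rule connected_graph_bridge_mem[OF con FE, of u w "{3, 7}"])
      (simp_all add: comb_edges_def insert_commute)
  note ends = simple_graph_edge_vertices[OF sg]
  show "has_center (\<lambda>v. int (v mod 3)) W"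
  proof (rule ccontr)
    assume "\<not> has_center (\<lambda>v. int (v mod 3)) W"
    then have twin: "\<exists>u \<in> comb_vertices. u \<in> W \<and> u \<noteq> v \<and> u mod 3 = v mod 3" if "v \<in> W" for v
      using that WV by (fastforce simp: has_center_def)
    have tw0: "0 \<in> W \<Longrightarrow> 3 \<in> W \<or> 6 \<in> W" using twin[of 0] by (simp add: comb_vertices_def)
    have tw1: "1 \<in> W \<Longrightarrow> 4 \<in> W \<or> 7 \<in> W" using twin[of 1] by (simp add: comb_vertices_def)
    have tw2: "2 \<in> W \<Longrightarrow> 5 \<in> W" using twin[of 2] by (simp add: comb_vertices_def)
    have tw3: "3 \<in> W \<Longrightarrow> 0 \<in> W \<or> 6 \<in> W" using twin[of 3] by (simp add: comb_vertices_def)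
    have tw4: "4 \<in> W \<Longrightarrow> 1 \<in> W \<or> 7 \<in> W" using twin[of 4] by (simp add: comb_vertices_def)
    have tw5: "5 \<in> W \<Longrightarrow> 2 \<in> W" using twin[of 5] by (simp add: comb_vertices_def)
    have tw6: "6 \<in> W \<Longrightarrow> 0 \<in> W \<or> 3 \<in> W" using twin[of 6] by (simp add: comb_vertices_def)
    have tw7: "7 \<in> W \<Longrightarrow> 1 \<in> W \<or> 4 \<in> W" using twin[of 7] by (simp add: comb_vertices_def)
    show False
    proof (cases "2 \<in> W")
      \<comment> \<open>The only twin of 2 is 5, so the path runs through 5, 1, 2 and cannot
        continue from 1 to 0. The twin of 1 is then 7, which forces the edge from 2 to 3; the twin
        of 3 is then 6, which makes 6 a third neighbor of 2 besides 1 and 3.\<close>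
      case True
      then have "5 \<in> W" by (rule tw2)
      then have e15: "{1, 5} \<in> F" using end5[of 2] True by simp
      have e12: "{1, 2} \<in> F" using cut12[of 5 2] True \<open>5 \<in> W\<close> by simp
      have no10: "{1, 0} \<notin> F" using deg[of 1 5 2 0] e15 e12 by auto
      have "0 \<notin> W" "4 \<notin> W" using cut01[of _ 2] True no10 by auto
      then have "7 \<in> W" using tw1 ends[OF e12] by blast
      then have e23: "{2, 3} \<in> F" using cut23[of 7 2] True by simp
      then have "6 \<in> W" using tw3 ends[OF e23] \<open>0 \<notin> W\<close> by blast
      then have "{2, 6} \<in> F" using end6[of 2] True by simp
      then show False using deg[of 2 1 3 6] e12 e23 by (simp add: insert_commute)
    next
      \<comment> \<open>Without 2, vertex 5 has no twin, and the path lies within one of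
        \<open>{0, 1, 4}\<close>, \<open>{3, 7}\<close> and \<open>{6}\<close>. Twins within one
        part are only 1 and 4, and these are joined only through 0, which has no twin there.\<close>
      case False
      then have n5: "5 \<notin> W" using tw5 by blast
      have n12: "{1, 2} \<notin> F" and n23: "{2, 3} \<notin> F" using ends False by blast+
      have n0: "0 \<notin> W" using tw0 cut12[of 0 3] cut12[of 0 6] n12 by auto
      then have n36: "3 \<notin> W" "6 \<notin> W" using tw3 tw6 cut23[of 3 6] n23 by auto
      have n7: "7 \<notin> W" using tw7 cut23[of 7 1] cut23[of 7 4] n23 by auto
      have "{1, 0} \<notin> F" using ends n0 by blast
      then have "1 \<notin> W" "4 \<notin> W" using tw1 tw4 cut01[of 4 1] n7 by auto
      then show False
        using \<open>W \<noteq> {}\<close> WV False n0 n36 n5 n7 by (auto simp: comb_vertices_def)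
    qed
  qed
qed

lemma comb_chi_cen_ge: "4 \<le> chi_cen comb_vertices comb_edges"
proof -
  have "finite comb_vertices" by (simp add: comb_vertices_def)
  then obtain c where c: "centered_coloring comb_vertices comb_edges c"
    "card (c ` comb_vertices) = chi_cen comb_vertices comb_edges"
    by (rule chi_cen_attained)
  \<comment> \<open>These are the disjoint paths 4 - 0 - 1 - 5 and 6 - 2 - 3 - 7, so every vertex of
    the comb misses one of them.\<close>
  have left: "3 \<le> card (c ` {4, 0, 1, 5})" and right: "3 \<le> card (c ` {6, 2, 3, 7})"
    by (rule centered_coloring_path_four[OF c(1) comb_simple]; simp add: comb_edges_iff)+
  have "Suc 3 \<le> card (c ` comb_vertices)"
  proof (rule centered_coloring_card_Suc[OF c(1) _ comb_connected])
    show "subgraph comb_vertices comb_edges comb_vertices comb_edges"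
      by (simp add: subgraph_def comb_simple)
    fix v assume "v \<in> comb_vertices"
    then have "{4, 0, 1, 5} \<subseteq> comb_vertices - {v} \<or> {6, 2, 3, 7} \<subseteq> comb_vertices - {v}"
      by (auto simp: comb_vertices_def)
    then show "\<exists>U \<subseteq> comb_vertices - {v}. 3 \<le> card (c ` U)"
      using left right by blast
  qed
  then show ?thesis using c(2) by simp
qed

lemma comb_chi_lin_le: "chi_lin comb_vertices comb_edges \<le> 3"
proof -
  have "chi_lin comb_vertices comb_edges \<le> card ((\<lambda>v. int (v mod 3)) ` comb_vertices)"
    by (rule chi_lin_le[OF comb_linear_coloring])
  also have "\<dots> \<le> card {0, 1, 2 :: int}"
    by (rule card_mono) (auto simp: comb_vertices_def)
  finally show ?thesis by simp
qed

theorem theorem4p8: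
  shows "(\<forall>(V :: 'a set) E. caterpillar V E \<longrightarrow> chi_cen V E \<le> chi_lin V E + 1) \<and>
         (\<exists>(V :: nat set) E. caterpillar V E \<and> chi_cen V E = chi_lin V E + 1)"
proof (intro conjI allI impI)
  show "chi_cen V E \<le> chi_lin V E + 1" if "caterpillar V E" for V :: "'a set" and E
    using that by (rule caterpillar_chi_cen_le)
  \<comment> \<open>The general bound closes the chain: 4 is at most \<open>chi_cen\<close>, which
    is at most \<open>chi_lin + 1\<close>, which is at most 4.\<close>
  have "chi_cen comb_vertices comb_edges = chi_lin comb_vertices comb_edges + 1"
    using caterpillar_chi_cen_le[OF comb_caterpillar] comb_chi_cen_ge comb_chi_lin_le by simp
  with comb_caterpillar
  show "\<exists>(V :: nat set) E. caterpillar V E \<and> chi_cen V E = chi_lin V E + 1" by blast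
qed

end
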